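(* Let $X \subseteq \mathbb{Z}^{p_1}\times\mathbb{R}^{n_1-p_1}$ be nonempty, $f_1,\dots,f_N:X\to\mathbb{R}$, $v^*:=\min_{\bm{x}\in X}\sum_{i=1}^N f_i(\bm{x})$, and $g_i^*(\bm{x}):=\frac1N\sum_{j=1}^N f_j(\bm{x})-f_i(\bm{x})$. Run the iterative GDD algorithm described in the context with parametric regularizers $g_i(\mathcal{X}^t,\cdot):X\to\mathbb{R}$, $i\in[N]$, $t\ge0$, and for each $i\in[N]$ let $\{\bm{x}^i_t: t\ge 0\}$ be the sequence of optimal solutions of scenario subproblem $i$ it produces. Suppose that 1. in each iteration $t$, $\sum_{i\in[N]} g_i(\mathcal{X}^t,\bm{x})\le 0$ for all $\bm{x}\in X$; 2. for all $i\in[N]$, any subsequence of $\{\bm{x}^i_t:t\ge0\}$ has a converging subsequence, denoted $\{\bm{x}^i_{(r)}: r\ge0\}$, such that $$\liminf_{r\to\infty}\big(f_i(\bm{x}^i_{(r)})+g_i^*(\bm{x}^i_{(r)})\big)\ \le\ \liminf_{r\to\infty}\big(f_i(\bm{x}^i_{(r)})+g_i(\mathcal{X}^{t(r)},\bm{x}^i_{(r)})\big),$$ where $t(r)$ is the iteration in which $\bm{x}^i_{(r)}$ is the optimal solution of scenario subproblem $i$. Then the sequence of lower bounds $\{\mathit{lb}_t\}$ produced by the algorithm converges to $v^*$.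
   Context: $[N]:=\{1,\dots,N\}$. Iterative GDD algorithm (run without stopping). Initialize $\mathcal{X}^0=\emptyset$, $g_i(\mathcal{X}^0,\cdot)=0$ for all $i\in[N]$, $\mathit{lb}=-\infty$. In iteration $t=0,1,2,\dots$: - for each $i\in[N]$, compute an optimal solution $\bm{x}^i_t$ of scenario subproblem $i$, $\min_{\bm{x}\in X}\{f_i(\bm{x})+g_i(\mathcal{X}^t,\bm{x})\}$ (assumed to exist); - update the lower bound: $\mathit{lb}_t := \max\{\mathit{lb}_{t-1},\ \sum_{i=1}^N (f_i(\bm{x}^i_t)+g_i(\mathcal{X}^t,\bm{x}^i_t))\}$ with $\mathit{lb}_{-1}:=-\infty$; - set $\mathcal{X}^{t+1}:=\mathcal{X}^t\cup\{\bm{x}^i_t: i\in[N]\}$ and choose new regularizers $g_i(\mathcal{X}^{t+1},\cdot):X\to\mathbb{R}$. (The algorithm also maintains an upper bound, which plays no role here.) The minimum defining $v^*$ is read as an infimum. *)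

theory Defs
  imports "HOL-Analysis.Analysis"
begin

text \<open>
  The space of integer and real coordinates is rendered inside \<open>real ^ 'n\<close>: \<open>J\<close> is the set of
  integer coordinates, so its cardinality is the number of integer variables (possibly none or all).
\<close>

definition mixed_integer_space :: "'n set \<Rightarrow> (real ^ 'n) set" where
  "mixed_integer_space J = {x. \<forall>j\<in>J. x $ j \<in> \<int>}"

text \<open>The infimum is taken in the extended reals, so no boundedness is presupposed.\<close>

definition opt_value :: "nat \<Rightarrow> 'a set \<Rightarrow> (nat \<Rightarrow> 'a \<Rightarrow> real) \<Rightarrow> ereal" where
  "opt_value N X f = (INF x\<in>X. ereal (\<Sum>i\<in>{1..N}. f i x))"

definition gstar :: "nat \<Rightarrow> (nat \<Rightarrow> 'a \<Rightarrow> real) \<Rightarrow> nat \<Rightarrow> 'a \<Rightarrow> real" where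
  "gstar N f i x = 1 / real N * (\<Sum>j\<in>{1..N}. f j x) - f i x"

text \<open>
  In the definitions below, \<open>x i t\<close> is the solution of scenario subproblem \<open>i\<close> found in iteration
  \<open>t\<close>, and \<open>gdd_points N x t\<close> is the set of all solutions found before iteration \<open>t\<close>.
\<close>

primrec gdd_points :: "nat \<Rightarrow> (nat \<Rightarrow> nat \<Rightarrow> 'a) \<Rightarrow> nat \<Rightarrow> 'a set" where
  "gdd_points N x 0 = {}"
| "gdd_points N x (Suc t) = gdd_points N x t \<union> (\<lambda>i. x i t) ` {1..N}"

text \<open>
  The regularizer of scenario \<open>i\<close> in iteration \<open>t\<close> is \<open>g t i S\<close>, with \<open>S\<close> the current point set.
  The extra argument \<open>t\<close> allows the regularizers to be chosen anew in each iteration, even when no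
  new point was found; a family depending on \<open>S\<close> alone is the special case where \<open>g\<close> ignores \<open>t\<close>.
\<close>

definition gdd_regularizer ::
  "nat \<Rightarrow> (nat \<Rightarrow> nat \<Rightarrow> 'a set \<Rightarrow> 'a \<Rightarrow> real) \<Rightarrow> (nat \<Rightarrow> nat \<Rightarrow> 'a) \<Rightarrow> nat \<Rightarrow> nat \<Rightarrow> 'a \<Rightarrow> real" where
  "gdd_regularizer N g x t i y = g t i (gdd_points N x t) y"

definition gdd_iter_value ::
  "nat \<Rightarrow> (nat \<Rightarrow> 'a \<Rightarrow> real) \<Rightarrow> (nat \<Rightarrow> nat \<Rightarrow> 'a set \<Rightarrow> 'a \<Rightarrow> real) \<Rightarrow> (nat \<Rightarrow> nat \<Rightarrow> 'a) \<Rightarrow> nat \<Rightarrow> real" where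
  "gdd_iter_value N f g x t = (\<Sum>i\<in>{1..N}. f i (x i t) + gdd_regularizer N g x t i (x i t))"

primrec gdd_lb ::
  "nat \<Rightarrow> (nat \<Rightarrow> 'a \<Rightarrow> real) \<Rightarrow> (nat \<Rightarrow> nat \<Rightarrow> 'a set \<Rightarrow> 'a \<Rightarrow> real) \<Rightarrow> (nat \<Rightarrow> nat \<Rightarrow> 'a) \<Rightarrow> nat \<Rightarrow> ereal" where
  "gdd_lb N f g x 0 = max (-\<infinity>) (ereal (gdd_iter_value N f g x 0))"
| "gdd_lb N f g x (Suc t) = max (gdd_lb N f g x t) (ereal (gdd_iter_value N f g x (Suc t)))"

definition gdd_run ::
  "nat \<Rightarrow> 'a set \<Rightarrow> (nat \<Rightarrow> 'a \<Rightarrow> real) \<Rightarrow> (nat \<Rightarrow> nat \<Rightarrow> 'a set \<Rightarrow> 'a \<Rightarrow> real) \<Rightarrow> (nat \<Rightarrow> nat \<Rightarrow> 'a) \<Rightarrow> bool" where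
  "gdd_run N X f g x \<longleftrightarrow>
     (\<forall>i\<in>{1..N}. \<forall>y\<in>X. gdd_regularizer N g x 0 i y = 0) \<and>
     (\<forall>t. \<forall>i\<in>{1..N}.
        is_arg_min (\<lambda>y. f i y + gdd_regularizer N g x t i y) (\<lambda>y. y \<in> X) (x i t))"

end

theory Submission
  imports Defs
begin

text \<open>
  Optimality of the scenario solutions and the first hypothesis bound every iteration value by \<open>v\<^sup>*\<close>;
  in particular \<open>v\<^sup>*\<close> is finite.  Conversely \<open>f\<^sub>i + g\<^sub>i\<^sup>*\<close> is the average of all the \<open>f\<^sub>j\<close>, hence
  at least \<open>v\<^sup>* / N\<close> on \<open>X\<close>.  The second hypothesis therefore bounds the limit inferior of each scenario
  value from below by \<open>v\<^sup>* / N\<close>: a subsequence staying strictly below that level has no admissible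
  further subsequence.  Summing over the scenarios squeezes the iteration values, and with them the
  lower bounds, towards \<open>v\<^sup>*\<close>.
\<close>

text \<open>If \<open>d < a t\<close> failed infinitely often, some subsequence would stay at or
  below \<open>d\<close>; so would the limit inferior along any reindexing \<open>r\<close> of it,
  against \<open>d < c\<close>.\<close>

lemma eventually_greater_of_subseq_liminf:
  fixes a :: "nat \<Rightarrow> 'a :: complete_linorder"
  assumes "\<And>s. strict_mono (s :: nat \<Rightarrow> nat) \<Longrightarrow> \<exists>r :: nat \<Rightarrow> nat. c \<le> liminf (\<lambda>k. a (s (r k)))"
    and "d < c"
  shows "\<forall>\<^sub>F t in sequentially. d < a t"
proof (rule ccontr)
  assume "\<not> (\<forall>\<^sub>F t in sequentially. d < a t)"
  then obtain s :: "nat \<Rightarrow> nat" where s: "strict_mono s" "\<And>n. a (s n) \<le> d"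
    by (metis not_eventually_sequentiallyD not_less)
  obtain r :: "nat \<Rightarrow> nat" where "c \<le> liminf (\<lambda>k. a (s (r k)))"
    using assms(1)[OF s(1)] by blast
  also have "\<dots> \<le> liminf (\<lambda>k. d)"
    by (rule Liminf_mono) (simp add: s(2))
  finally show False
    using \<open>d < c\<close> by (simp add: Liminf_const)
qed

text \<open>Each \<open>x i t\<close> does at least as well as the common point \<open>y\<close> in
  its own subproblem; after summation the regularizers at \<open>y\<close> contribute at most
  0.\<close>

lemma gdd_iter_value_le_sum:
  assumes "gdd_run N X f g x" and "y \<in> X"
    and "(\<Sum>i\<in>{1..N}. gdd_regularizer N g x t i y) \<le> 0"
  shows "gdd_iter_value N f g x t \<le> (\<Sum>i\<in>{1..N}. f i y)"
proof -
  have "gdd_iter_value N f g x t \<le> (\<Sum>i\<in>{1..N}. f i y + gdd_regularizer N g x t i y)"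
    unfolding gdd_iter_value_def using assms(1,2)
    by (intro sum_mono) (force simp: gdd_run_def is_arg_min_linorder)
  also have "\<dots> = (\<Sum>i\<in>{1..N}. f i y) + (\<Sum>i\<in>{1..N}. gdd_regularizer N g x t i y)"
    by (rule sum.distrib)
  finally show ?thesis
    using assms(3) by linarith
qed

lemma gdd_iter_value_le_gdd_lb: "ereal (gdd_iter_value N f g x t) \<le> gdd_lb N f g x t"
  by (cases t) auto

lemma gdd_lb_le:
  assumes "\<And>t. ereal (gdd_iter_value N f g x t) \<le> c"
  shows "gdd_lb N f g x t \<le> c"
  by (induction t) (use assms in auto)

theorem theorem2:
  fixes N :: nat
    and J :: "'n::finite set"
    and X :: "(real ^ 'n) set"
    and f :: "nat \<Rightarrow> real ^ 'n \<Rightarrow> real"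
    and g :: "nat \<Rightarrow> nat \<Rightarrow> (real ^ 'n) set \<Rightarrow> real ^ 'n \<Rightarrow> real"
    and x :: "nat \<Rightarrow> nat \<Rightarrow> real ^ 'n"
  assumes "N \<ge> 1"
    and "X \<subseteq> mixed_integer_space J"
    and "X \<noteq> {}"
    and "gdd_run N X f g x"
    and "\<And>t y. y \<in> X \<Longrightarrow> (\<Sum>i\<in>{1..N}. gdd_regularizer N g x t i y) \<le> 0"
    and "\<And>i s. i \<in> {1..N} \<Longrightarrow> strict_mono (s :: nat \<Rightarrow> nat) \<Longrightarrow>
           \<exists>r :: nat \<Rightarrow> nat. strict_mono r \<and>
             convergent (\<lambda>k. x i (s (r k))) \<and>
             liminf (\<lambda>k. ereal (f i (x i (s (r k))) + gstar N f i (x i (s (r k)))))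
               \<le> liminf (\<lambda>k. ereal (f i (x i (s (r k)))
                     + gdd_regularizer N g x (s (r k)) i (x i (s (r k)))))"
  shows "gdd_lb N f g x \<longlonglongrightarrow> opt_value N X f"
proof -
  have opt_le: "opt_value N X f \<le> ereal (\<Sum>i\<in>{1..N}. f i y)" if "y \<in> X" for y
    unfolding opt_value_def using that by (rule INF_lower)
  have iter_le: "ereal (gdd_iter_value N f g x t) \<le> opt_value N X f" for t
    unfolding opt_value_def
    by (intro INF_greatest, simp only: ereal_less_eq,
        rule gdd_iter_value_le_sum[OF assms(4)]) (use assms(5) in auto)
  \<comment> \<open>A real iteration value from below and the objective at some point of
    \<open>X\<close> from above exclude both infinities.\<close>
  obtain v where v: "opt_value N X f = ereal v"
    using iter_le[of 0] opt_le \<open>X \<noteq> {}\<close> by (cases "opt_value N X f") auto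
  have x_mem: "x i t \<in> X" if "i \<in> {1..N}" for i t
    using assms(4) that by (auto simp: gdd_run_def is_arg_min_def)
  have average_ge: "v / real N \<le> f i y + gstar N f i y" if "y \<in> X" for i y
    using opt_le[OF that] \<open>N \<ge> 1\<close> by (simp add: v gstar_def divide_right_mono)
  \<comment> \<open>Stated in \<open>ereal\<close>, a complete order, where the limit inferior
    always exists.\<close>
  have scenario: "\<forall>\<^sub>F t in sequentially.
      ereal d < ereal (f i (x i t) + gdd_regularizer N g x t i (x i t))"
    if i: "i \<in> {1..N}" and d: "d < v / real N" for i d
  proof (rule eventually_greater_of_subseq_liminf)
    show "ereal d < ereal (v / real N)"
      using d by simp
  next
    fix s :: "nat \<Rightarrow> nat"
    assume "strict_mono s"
    from assms(6)[OF i this] obtain r :: "nat \<Rightarrow> nat" where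
      r: "liminf (\<lambda>k. ereal (f i (x i (s (r k))) + gstar N f i (x i (s (r k)))))
        \<le> liminf (\<lambda>k. ereal (f i (x i (s (r k)))
              + gdd_regularizer N g x (s (r k)) i (x i (s (r k)))))"
      by blast
    have "ereal (v / real N)
        \<le> liminf (\<lambda>k. ereal (f i (x i (s (r k))) + gstar N f i (x i (s (r k)))))"
      by (rule Liminf_bounded) (simp add: average_ge x_mem[OF i])
    with r show "\<exists>r :: nat \<Rightarrow> nat. ereal (v / real N)
        \<le> liminf (\<lambda>k. ereal (f i (x i (s (r k)))
              + gdd_regularizer N g x (s (r k)) i (x i (s (r k)))))"
      using order_trans by blast
  qed
  have lb_gt: "\<forall>\<^sub>F t in sequentially. ereal d < gdd_lb N f g x t" if "d < v" for d
  proof -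
    \<comment> \<open>The target \<open>d\<close> is split equally: finitely many scenarios
      eventually all exceed \<open>d / real N\<close> at once, and their sum then exceeds
      \<open>d\<close>.\<close>
    have "d / real N < v / real N"
      using that \<open>N \<ge> 1\<close> by (simp add: divide_strict_right_mono)
    then have "\<forall>\<^sub>F t in sequentially. \<forall>i\<in>{1..N}.
        ereal (d / real N) < ereal (f i (x i t) + gdd_regularizer N g x t i (x i t))"
      by (intro eventually_ball_finite ballI scenario) simp_all
    then show ?thesis
    proof eventually_elim
      case (elim t)
      have "(\<Sum>i\<in>{1..N}. d / real N) < gdd_iter_value N f g x t"
        unfolding gdd_iter_value_def using elim \<open>N \<ge> 1\<close> by (intro sum_strict_mono) auto
      then have "ereal d < ereal (gdd_iter_value N f g x t)"
        using \<open>N \<ge> 1\<close> by simp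
      then show ?case
        using gdd_iter_value_le_gdd_lb by (rule less_le_trans)
    qed
  qed
  show ?thesis
  proof (rule order_tendstoI)
    fix a
    assume "a < opt_value N X f"
    \<comment> \<open>As \<open>a\<close> may be minus infinity, a real \<open>d\<close> is
      interpolated so that \<open>lb_gt\<close> applies.\<close>
    then obtain d where "a < ereal d" "d < v"
      unfolding v by (metis ereal_dense2 less_ereal.simps(1))
    with lb_gt[OF \<open>d < v\<close>] show "\<forall>\<^sub>F t in sequentially. a < gdd_lb N f g x t"
      by (auto elim!: eventually_mono)
  next
    fix a
    assume "opt_value N X f < a"
    with gdd_lb_le[OF iter_le] show "\<forall>\<^sub>F t in sequentially. gdd_lb N f g x t < a"
      by (intro always_eventually allI) (rule le_less_trans)
  qed
qed

end
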